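(* Let $0<\theta<1$. (a) (Geometric tempered stable.) Let $\lambda>0$ and $0<\beta<1$, and let $f$ be the probability density function on $(0,\infty)$ whose Laplace transform is $W(s)=\frac{1}{1+\theta((s+\lambda)^\beta-\lambda^\beta)}$. Then, as $x\to 0^+$, $f(x)\sim \frac{x^{\beta-1}}{\theta\,\Gamma(\beta)}$. (b) (Geometric inverse Gaussian.) Let $\delta>0$ and $\gamma>0$, and let $f$ be the probability density function on $(0,\infty)$ whose Laplace transform is $W(s)=\frac{1}{1+\theta\delta\{\sqrt{\gamma^2+2s}-\gamma\}}$. Then, as $x\to 0^+$, $f(x)\sim \frac{x^{-1/2}}{\theta\delta\sqrt{2\pi}}$.
   Context: The Laplace transform of a density $f$ on $(0,\infty)$ is $W(s)=\int_0^\infty e^{-sx}f(x)\,dx$, $s>0$. The notation $f(x)\sim h(x)$ as $x\to0^+$ means $f(x)/h(x)\to 1$ as $x\to 0^+$. *)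

theory Defs
  imports "HOL-Probability.Probability"
begin

text \<open>Functions on the half-line \<open>(0, \<infinity>)\<close> are represented by functions on the reals whose values
  at \<open>x \<le> 0\<close> are irrelevant.\<close>

definition pdf_on_pos :: "(real \<Rightarrow> real) \<Rightarrow> bool" where
  "pdf_on_pos f \<longleftrightarrow>
     set_integrable lborel {0<..} f \<and> (\<forall>x>0. 0 \<le> f x) \<and> (LINT x:{0<..}|lborel. f x) = 1"

definition laplace_transform :: "(real \<Rightarrow> real) \<Rightarrow> real \<Rightarrow> real" where
  "laplace_transform f s = (LINT x:{0<..}|lborel. exp (- s * x) * f x)"

text \<open>A density is determined by its Laplace transform only up to Lebesgue null sets, so a pointwise
  statement such as \<open>f(x) \<sim> h(x)\<close> refers to the continuous version of the density.  That version
  is unique on \<open>(0, \<infinity>)\<close> if it exists; a density that is itself continuous there is its own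
  continuous version.\<close>

definition continuous_version :: "(real \<Rightarrow> real) \<Rightarrow> (real \<Rightarrow> real) \<Rightarrow> bool" where
  "continuous_version f g \<longleftrightarrow>
     continuous_on {0<..} g \<and> (AE x in lborel. 0 < x \<longrightarrow> g x = f x)"

end

theory Submission
  imports Defs
begin

text \<open>With \<open>p = s + \<lambda>\<close> and \<open>c = 1 / \<theta> - \<lambda>\<^sup>\<beta>\<close> the transform is \<open>(1 / \<theta>) / (p\<^sup>\<beta> + c)\<close>, which for large \<open>p\<close>
  expands as a geometric series in \<open>- c / p\<^sup>\<beta>\<close>.  Inverting it term by term gives the explicit density
  \<open>exp (- \<lambda> x) x powr (\<beta> - 1) E(x\<^sup>\<beta>) / \<theta>\<close> with an entire function \<open>E\<close> of Mittag-Leffler type and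
  \<open>E(0) = 1 / \<Gamma>(\<beta>)\<close>.  A Laplace transform known for all large arguments determines its density
  almost everywhere, hence the continuous version everywhere on \<open>(0, \<infinity>)\<close>.  The geometric inverse
  Gaussian case is the case \<open>\<beta> = 1 / 2\<close>, \<open>\<lambda> = \<gamma>\<^sup>2 / 2\<close> with \<open>\<theta> \<delta> \<surd>2\<close> in place of \<open>\<theta>\<close>.\<close>

section \<open>Uniqueness of the density from its Laplace transform\<close>

text \<open>The positive and negative parts of \<open>h\<close> are the densities of two measures
  that are finite and equal on every half-line. Half-lines generate the Borel sets, so the measures
  coincide, and then so do their densities almost everywhere.\<close>

lemma AE_zero_if_integral_greaterThan_zero:
  fixes h :: "real \<Rightarrow> real"
  assumes h: "integrable lborel h"
    and zero: "\<And>a. (LINT x:{a<..}|lborel. h x) = 0"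
  shows "AE x in lborel. h x = 0"
proof -
  have [measurable]: "h \<in> borel_measurable borel"
    using h by simp
  let ?P = "density lborel (\<lambda>x. ennreal (h x))" and ?N = "density lborel (\<lambda>x. ennreal (- h x))"
  have int: "integrable lborel (\<lambda>x. indicator {a<..} x * h x)" for a
    using integrable_mult_indicator[OF _ h, of "{a<..}"] by simp
  have P: "emeasure ?P {a<..} = (\<integral>\<^sup>+x. ennreal (indicator {a<..} x * h x) \<partial>lborel)" for a
    by (subst emeasure_density) (auto intro!: nn_integral_cong simp: indicator_def)
  have N: "emeasure ?N {a<..} = (\<integral>\<^sup>+x. ennreal (- (indicator {a<..} x * h x)) \<partial>lborel)" for a
    by (subst emeasure_density) (auto intro!: nn_integral_cong simp: indicator_def)
  have fin: "emeasure ?P {a<..} < \<infinity>" "emeasure ?N {a<..} < \<infinity>" for a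
    unfolding P N using real_integrable_def[THEN iffD1, OF int[of a]] by (auto simp: less_top)
  have "?P = ?N"
  proof (rule measure_eqI_lessThan)
    fix a
    have "enn2real (emeasure ?P {a<..}) - enn2real (emeasure ?N {a<..}) = 0"
      unfolding P N using zero[of a] real_lebesgue_integral_def[OF int[of a]]
      by (simp add: set_lebesgue_integral_def)
    then show "emeasure ?P {a<..} = emeasure ?N {a<..}"
      using fin[of a] by (metis ennreal_enn2real eq_iff_diff_eq_0 infinity_ennreal_def)
  qed (use fin in auto)
  then have "AE x in lborel. ennreal (h x) = ennreal (- h x)"
    by (intro sigma_finite_measure.density_unique[OF sigma_finite_lborel]) auto
  \<comment> \<open>Since \<open>ennreal\<close> sends negative numbers to 0, at most one of
    \<open>ennreal (h x)\<close> and \<open>ennreal (- h x)\<close> is nonzero; equality forces both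
    to vanish.\<close>
  then show ?thesis
    by eventually_elim (metis ennreal_eq_0_iff ennreal_neg linorder_linear neg_0_le_iff_le neg_le_0_iff_le
        order_antisym)
qed

text \<open>By Weierstrass, vanishing against the powers of \<open>exp (- x)\<close> means vanishing against every
  continuous function of \<open>exp (- x)\<close>, and these approximate the indicators of half-lines.\<close>
lemma exp_moments_zero_imp_AE_zero:
  fixes k :: "real \<Rightarrow> real"
  assumes k: "integrable lborel k"
    and supp: "\<And>x. x \<le> 0 \<Longrightarrow> k x = 0"
    and moments: "\<And>n::nat. (LINT x|lborel. exp (- x) ^ n * k x) = 0"
  shows "AE x in lborel. k x = 0"
proof -
  have [measurable]: "k \<in> borel_measurable borel"
    using k by simp
  \<comment> \<open>Only the values of a test function on the compact interval \<open>{0..1}\<close>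
    matter, which is where Weierstrass approximation is uniform.\<close>
  have exp01: "exp (- x) \<in> {0..1}" if "k x \<noteq> 0" for x
    using supp[of x] that by (cases "x \<le> 0") auto
  have integrable: "integrable lborel (\<lambda>x. \<phi> (exp (- x)) * k x)"
    if \<phi>: "continuous_on UNIV \<phi>" for \<phi> :: "real \<Rightarrow> real"
  proof -
    have [measurable]: "\<phi> \<in> borel_measurable borel"
      using \<phi> by (rule borel_measurable_continuous_onI)
    have "bounded (\<phi> ` {0..1})"
      using \<phi> by (intro compact_imp_bounded compact_continuous_image) (auto intro: continuous_on_subset)
    then obtain B where B: "\<And>y. y \<in> {0..1} \<Longrightarrow> \<bar>\<phi> y\<bar> \<le> B"
      by (fastforce simp: bounded_iff)
    have "\<bar>\<phi> (exp (- x)) * k x\<bar> \<le> \<bar>B * k x\<bar>" for x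
      using exp01[of x] B[of "exp (- x)"] by (cases "k x = 0") (auto simp: abs_mult intro!: mult_right_mono)
    then show ?thesis
      by (intro Bochner_Integration.integrable_bound[OF integrable_mult_right[OF k, of B]]) auto
  qed
  have continuous: "(LINT x|lborel. \<phi> (exp (- x)) * k x) = 0"
    if \<phi>: "continuous_on UNIV \<phi>" for \<phi> :: "real \<Rightarrow> real"
  proof -
    let ?K = "LINT x|lborel. \<bar>k x\<bar>" and ?I = "LINT x|lborel. \<phi> (exp (- x)) * k x"
    \<comment> \<open>A polynomial \<open>g\<close> within \<open>e\<close> of \<open>\<phi>\<close>
      on \<open>{0..1}\<close> integrates to 0 against \<open>k\<close> by the moment hypothesis, so
      \<open>?I\<close> equals the integral of the error alone.\<close>
    have le: "\<bar>?I\<bar> \<le> e * ?K" if "e > 0" for e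
    proof -
      obtain g where g: "real_polynomial_function g" "\<And>y. y \<in> {0..1} \<Longrightarrow> \<bar>\<phi> y - g y\<bar> < e"
        using Stone_Weierstrass_real_polynomial_function[of "{0..1}" \<phi> e] \<phi> \<open>e > 0\<close>
        by (auto intro: continuous_on_subset)
      then obtain a n where g_def: "g = (\<lambda>x. \<Sum>i\<le>n::nat. a i * x ^ i)"
        by (auto simp: real_polynomial_function_iff_sum)
      have g_int: "integrable lborel (\<lambda>x. g (exp (- x)) * k x)"
        unfolding g_def by (intro integrable continuous_intros)
      have mono_int: "integrable lborel (\<lambda>x. exp (- x) ^ i * k x)" for i
        by (intro integrable[where \<phi> = "\<lambda>y. y ^ i"] continuous_intros)
      have "(LINT x|lborel. g (exp (- x)) * k x) = (LINT x|lborel. (\<Sum>i\<le>n. a i * (exp (- x) ^ i * k x)))"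
        by (simp add: g_def sum_distrib_right mult.assoc)
      also have "\<dots> = 0"
        using mono_int by (subst Bochner_Integration.integral_sum) (auto simp: moments)
      finally have "?I = (LINT x|lborel. \<phi> (exp (- x)) * k x - g (exp (- x)) * k x)"
        using g_int integrable[OF \<phi>] by simp
      also have "\<bar>\<dots>\<bar> \<le> (LINT x|lborel. \<bar>\<phi> (exp (- x)) * k x - g (exp (- x)) * k x\<bar>)"
        by (rule integral_abs_bound)
      also have "\<dots> \<le> (LINT x|lborel. e * \<bar>k x\<bar>)"
      proof (rule integral_mono)
        show "\<bar>\<phi> (exp (- x)) * k x - g (exp (- x)) * k x\<bar> \<le> e * \<bar>k x\<bar>" for x
          using exp01[of x] g(2)[of "exp (- x)"]
          by (cases "k x = 0") (auto simp: abs_mult left_diff_distrib[symmetric] intro!: mult_right_mono)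
      qed (use g_int integrable[OF \<phi>] k in auto)
      finally show ?thesis
        by simp
    qed
    have "((\<lambda>e. e * ?K) \<longlongrightarrow> 0 * ?K) (at_right 0)"
      by (intro tendsto_intros)
    then have "\<bar>?I\<bar> \<le> 0 * ?K"
      by (rule tendsto_lowerbound) (auto simp: eventually_at_right_less intro: le eventually_mono[OF eventually_at_right_less])
    then show ?thesis
      by simp
  qed
  show ?thesis
  proof (rule AE_zero_if_integral_greaterThan_zero[OF k])
    fix a :: real
    \<comment> \<open>Ramps of slope \<open>- m\<close> that vanish for
      \<open>y \<ge> exp (- a)\<close> and are capped at 1. As \<open>exp (- x)\<close> is
      decreasing, at \<open>y = exp (- x)\<close> they converge to the indicator of the open
      half-line beyond \<open>a\<close>, including the value 0 at \<open>x = a\<close>.\<close>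
    define \<phi> where "\<phi> = (\<lambda>m y. min 1 (max 0 (real m * (exp (- a) - y))))"
    have cont: "continuous_on UNIV (\<phi> m)" for m
      unfolding \<phi>_def by (intro continuous_intros)
    have lim: "(\<lambda>m. \<phi> m (exp (- x))) \<longlonglongrightarrow> indicator {a<..} x" for x
    proof (cases "a < x")
      case True
      then have d: "0 < exp (- a) - exp (- x)"
        by simp
      have "filterlim (\<lambda>m. real m * (exp (- a) - exp (- x))) at_top sequentially"
        using filterlim_tendsto_pos_mult_at_top[OF tendsto_const d filterlim_real_sequentially]
        by (simp add: mult.commute)
      then have "\<forall>\<^sub>F m in sequentially. 1 \<le> real m * (exp (- a) - exp (- x))"
        by (simp add: filterlim_at_top)
      then have "\<forall>\<^sub>F m in sequentially. \<phi> m (exp (- x)) = 1"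
        by eventually_elim (auto simp: \<phi>_def)
      then show ?thesis
        using True by (simp add: tendsto_eventually)
    next
      case False
      then have "real m * (exp (- a) - exp (- x)) \<le> 0" for m
        by (intro mult_nonneg_nonpos) auto
      then have "\<phi> m (exp (- x)) = 0" for m
        by (simp add: \<phi>_def max_absorb1)
      then show ?thesis
        using False by simp
    qed
    have "(\<lambda>m. LINT x|lborel. \<phi> m (exp (- x)) * k x) \<longlonglongrightarrow> (LINT x|lborel. indicator {a<..} x * k x)"
    proof (rule integral_dominated_convergence[where w = "\<lambda>x. \<bar>k x\<bar>"])
      show "AE x in lborel. (\<lambda>m. \<phi> m (exp (- x)) * k x) \<longlonglongrightarrow> indicator {a<..} x * k x"
        by (intro AE_I2 tendsto_mult lim tendsto_const)
      have "\<bar>\<phi> m y\<bar> \<le> 1" for m y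
        by (auto simp: \<phi>_def)
      then show "AE x in lborel. norm (\<phi> m (exp (- x)) * k x) \<le> \<bar>k x\<bar>" for m
        by (intro AE_I2) (auto simp: abs_mult intro!: mult_left_le_one_le)
    qed (use k integrable[OF cont] in auto)
    then show "(LINT x:{a<..}|lborel. k x) = 0"
      by (simp add: continuous[OF cont] set_lebesgue_integral_def LIMSEQ_const_iff)
  qed
qed

text \<open>The points of \<open>S\<close> where the two functions differ form an open null set, and
  a nonempty open set is never null. This is what makes a continuous version unique.\<close>

lemma AE_eq_imp_eq_on_open:
  fixes g h :: "'a::euclidean_space \<Rightarrow> real"
  assumes "open S" and "continuous_on S g" and "continuous_on S h"
    and ae: "AE x in lborel. x \<in> S \<longrightarrow> g x = h x"
    and "x \<in> S"
  shows "g x = h x"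
proof (rule ccontr)
  assume "g x \<noteq> h x"
  let ?U = "{y \<in> S. g y - h y \<in> - {0}}"
  have "open (S \<inter> (\<lambda>y. g y - h y) -` (- {0}))"
    using assms by (intro continuous_open_preimage continuous_intros) auto
  then have "open ?U"
    by (simp add: Collect_conj_eq vimage_def)
  moreover have "x \<in> ?U"
    using \<open>g x \<noteq> h x\<close> \<open>x \<in> S\<close> by simp
  moreover have "negligible ?U"
  proof -
    have "?U \<in> sets lborel"
      using \<open>open ?U\<close> by simp
    with ae have "?U \<in> null_sets lborel"
      by (auto simp: AE_iff_null_sets elim: eventually_mono)
    then show ?thesis
      by (simp add: negligible_iff_null_sets null_sets_completionI)
  qed
  ultimately show False
    using open_not_negligible by blast
qed

section \<open>Mittag-Leffler series and their Laplace transforms\<close>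

text \<open>Substitute \<open>t = p * x\<close> in Euler's integral for Gamma. Working with
  nonnegative integrals yields integrability together with the value.\<close>

lemma laplace_powr:
  fixes a p :: real
  assumes "a > 0" "p > 0"
  shows "has_bochner_integral lborel (\<lambda>x. indicator {0<..} x * (x powr (a - 1) * exp (- p * x))) (Gamma a / p powr a)"
proof (rule has_bochner_integral_nn_integral)
  let ?f = "\<lambda>t. ennreal (indicator {0..} t * t powr (a - 1) / exp t)"
  have "ennreal (Gamma a) = (\<integral>\<^sup>+t. ?f t \<partial>lborel)"
    by (rule Gamma_conv_nn_integral_real) fact
  also have "\<dots> = ennreal p * (\<integral>\<^sup>+x. ?f (p * x) \<partial>lborel)"
    using nn_integral_real_affine[of ?f p 0] \<open>p > 0\<close> by simp
  also have "(\<integral>\<^sup>+x. ?f (p * x) \<partial>lborel)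
      = (\<integral>\<^sup>+x. ennreal (p powr (a - 1)) * ennreal (indicator {0<..} x * (x powr (a - 1) * exp (- p * x))) \<partial>lborel)"
    using \<open>p > 0\<close>
    by (intro nn_integral_cong)
      (auto simp: indicator_def powr_mult exp_minus field_simps zero_le_mult_iff ennreal_mult[symmetric])
  also have "\<dots> = ennreal (p powr (a - 1)) * (\<integral>\<^sup>+x. ennreal (indicator {0<..} x * (x powr (a - 1) * exp (- p * x))) \<partial>lborel)"
    by (rule nn_integral_cmult) auto
  finally have "ennreal (p powr - a) * ennreal (Gamma a)
      = ennreal (p powr - a * p powr a) * (\<integral>\<^sup>+x. ennreal (indicator {0<..} x * (x powr (a - 1) * exp (- p * x))) \<partial>lborel)"
    using \<open>p > 0\<close> by (simp add: mult.assoc[symmetric] ennreal_mult[symmetric] powr_diff)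
  moreover have "p powr - a * p powr a = 1"
    using \<open>p > 0\<close> by (simp flip: powr_add)
  ultimately show "(\<integral>\<^sup>+x. ennreal (indicator {0<..} x * (x powr (a - 1) * exp (- p * x))) \<partial>lborel) = ennreal (Gamma a / p powr a)"
    using \<open>a > 0\<close>
    by (simp add: ennreal_mult[symmetric] Gamma_real_pos less_imp_le powr_minus divide_inverse mult.commute)
qed (use assms in \<open>auto simp: indicator_def Gamma_real_pos less_imp_le\<close>)

text \<open>Restrict Euler's integral to \<open>{T..T + 1}\<close> and bound each factor of the
  integrand below by its least value there. As \<open>T\<close> is free, Gamma outgrows every
  exponential, which makes the Mittag-Leffler series converge everywhere.\<close>

lemma Gamma_lower_bound:
  fixes z T :: real
  assumes "z \<ge> 1" "T > 0"
  shows "T powr (z - 1) * exp (- (T + 1)) \<le> Gamma z"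
proof -
  have "ennreal (T powr (z - 1) * exp (- (T + 1)))
      = (\<integral>\<^sup>+t. ennreal (T powr (z - 1) * exp (- (T + 1))) * indicator {T..T + 1} t \<partial>lborel)"
    by (subst nn_integral_cmult_indicator) auto
  also have "\<dots> \<le> (\<integral>\<^sup>+t. ennreal (indicator {0..} t * t powr (z - 1) / exp t) \<partial>lborel)"
    using assms
    by (intro nn_integral_mono)
      (auto simp: indicator_def exp_minus divide_inverse intro!: mult_mono powr_mono2 simp flip: exp_minus)
  also have "\<dots> = ennreal (Gamma z)"
    using assms by (simp add: Gamma_conv_nn_integral_real)
  finally show ?thesis
    using assms by (simp add: ennreal_le_iff Gamma_real_pos less_imp_le)
qed

text \<open>In the usual two-parameter notation this is \<open>E\<^bsub>b,b\<^esub>(- c z)\<close>.\<close>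
definition mittag_leffler :: "real \<Rightarrow> real \<Rightarrow> real \<Rightarrow> real" where
  "mittag_leffler b c z = (\<Sum>n. (- c) ^ n / Gamma (b * (real n + 1)) * z ^ n)"

lemma summable_power_over_Gamma:
  fixes b r :: real
  assumes "b > 0" "r \<ge> 0"
  shows "summable (\<lambda>n. r ^ n / Gamma (b * (real n + 1)))"
proof -
  \<comment> \<open>With this \<open>T\<close> the Gamma bound grows like
    \<open>(2 * r + 1) ^ n\<close>, so the terms are dominated by powers of
    \<open>r / (2 * r + 1)\<close>, which is below 1/2. The summand 1 keeps \<open>T\<close>
    positive when \<open>r = 0\<close>.\<close>
  define T where "T = (2 * r + 1) powr (1 / b)"
  have T: "T > 0" "T powr b = 2 * r + 1"
    using assms by (auto simp: T_def powr_powr)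
  \<comment> \<open>\<open>C\<close> collects the factors of the Gamma bound that do not depend on
    \<open>n\<close>.\<close>
  define C where "C = exp (T + 1) * T / (2 * r + 1)"
  have "C > 0"
    using T assms by (simp add: C_def)
  have bound: "norm (r ^ n / Gamma (b * (real n + 1))) \<le> C * (1 / 2) ^ n"
    \<comment> \<open>From this index on, the Gamma argument is at least 1, as
      \<open>Gamma_lower_bound\<close> requires.\<close>
    if n: "n \<ge> nat \<lceil>1 / b\<rceil>" for n
  proof -
    have "1 / b \<le> real n"
      using n by linarith
    then have z: "b * (real n + 1) \<ge> 1"
      using assms by (simp add: field_simps)
    have "(2 * r + 1) ^ n / C = T powr (b * (real n + 1) - 1) * exp (- (T + 1))"
    proof -
      have "T powr (b * (real n + 1) - 1) = (T powr b) powr real n * T powr b / T"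
        using T(1) by (simp add: powr_diff powr_add powr_powr distrib_left)
      also have "\<dots> = (2 * r + 1) ^ n * (2 * r + 1) / T"
        unfolding T(2) using assms by (simp add: powr_realpow)
      finally have "T powr (b * (real n + 1) - 1) = (2 * r + 1) ^ n * (2 * r + 1) / T" .
      moreover have "exp (- (T + 1)) = 1 / exp (T + 1)"
        by (simp only: exp_minus inverse_eq_divide)
      ultimately show ?thesis
        using T assms by (simp add: C_def)
    qed
    also have "\<dots> \<le> Gamma (b * (real n + 1))"
      using z T by (intro Gamma_lower_bound)
    finally have le: "(2 * r + 1) ^ n / C \<le> Gamma (b * (real n + 1))" .
    have "norm (r ^ n / Gamma (b * (real n + 1))) = r ^ n / Gamma (b * (real n + 1))"
      using assms z by (simp add: Gamma_real_pos)
    also have "\<dots> \<le> r ^ n / ((2 * r + 1) ^ n / C)"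
      using assms \<open>C > 0\<close> le by (intro divide_left_mono) (auto simp: Gamma_real_pos)
    also have "\<dots> = C * (r / (2 * r + 1)) ^ n"
      by (simp add: power_divide)
    also have "\<dots> \<le> C * (1 / 2) ^ n"
      using assms \<open>C > 0\<close> by (intro mult_left_mono power_mono) (auto simp: field_simps)
    finally show ?thesis .
  qed
  show ?thesis
    by (rule summable_comparison_test'[where g = "\<lambda>n. C * (1 / 2) ^ n"])
      (rule summable_mult, rule summable_geometric, simp, rule bound)
qed

lemma summable_mittag_leffler:
  fixes b c z :: real
  assumes "b > 0"
  shows "summable (\<lambda>n. norm ((- c) ^ n / Gamma (b * (real n + 1)) * z ^ n))"
proof -
  have "norm ((- c) ^ n / Gamma (b * (real n + 1)) * z ^ n) = (\<bar>c\<bar> * \<bar>z\<bar>) ^ n / Gamma (b * (real n + 1))" for n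
    using assms by (simp add: abs_mult power_mult_distrib power_abs Gamma_real_pos less_imp_le)
  then show ?thesis
    using summable_power_over_Gamma[OF assms, of "\<bar>c\<bar> * \<bar>z\<bar>"] by simp
qed

lemma isCont_mittag_leffler:
  fixes b c z :: real
  assumes "b > 0"
  shows "isCont (mittag_leffler b c) z"
  using isCont_powser_converges_everywhere[OF summable_norm_cancel[OF summable_mittag_leffler[OF assms]]]
  by (simp add: mittag_leffler_def[abs_def])

lemma mittag_leffler_0: "mittag_leffler b c 0 = 1 / Gamma b"
  using powser_zero[of "\<lambda>n. (- c) ^ n / Gamma (b * (real n + 1))"] by (simp add: mittag_leffler_def)

text \<open>Integrating term by term cancels the Gamma factors and leaves a geometric series with
  ratio \<open>- c / p powr b\<close>. The bound on \<open>c\<close> makes the integrals of the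
  absolute values summable as well, which justifies the interchange.\<close>

lemma laplace_mittag_leffler:
  fixes b c p :: real
  assumes "b > 0" "p > 0" "\<bar>c\<bar> < p powr b"
  shows "has_bochner_integral lborel
    (\<lambda>x. indicator {0<..} x * (x powr (b - 1) * mittag_leffler b c (x powr b) * exp (- p * x)))
    (1 / (p powr b + c))"
proof -
  define a where "a n = b * (real n + 1)" for n
  have a: "a n > 0" for n
    using assms by (simp add: a_def)
  define q where "q n = (- c) ^ n / Gamma (a n)" for n
  define F where "F n x = q n * (indicator {0<..} x * (x powr (a n - 1) * exp (- p * x)))" for n x
  have powr_a: "x powr (a n - 1) = x powr (b - 1) * (x powr b) ^ n" if "x > 0" for n x
    using that by (simp add: a_def powr_diff powr_add distrib_left powr_powr flip: powr_realpow)
  have p_a: "p powr a n = p powr b * (p powr b) ^ n" for n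
    using assms by (simp add: a_def powr_add distrib_left powr_powr flip: powr_realpow)
  have F_eq: "F n x = indicator {0<..} x * x powr (b - 1) * exp (- p * x) * (q n * (x powr b) ^ n)" for n x
    by (simp add: F_def powr_a indicator_def)
  have F_sum: "(\<Sum>n. F n x)
      = indicator {0<..} x * (x powr (b - 1) * mittag_leffler b c (x powr b) * exp (- p * x))" for x
    using summable_norm_cancel[OF summable_mittag_leffler[OF \<open>b > 0\<close>, of c "x powr b"]]
    unfolding F_eq mittag_leffler_def q_def a_def by (subst suminf_mult) (simp_all only: mult_ac)
  have F_int: "has_bochner_integral lborel (F n) (q n * (Gamma (a n) / p powr a n))" for n
    unfolding F_def by (intro has_bochner_integral_mult_right laplace_powr a assms)
  have F_norm: "has_bochner_integral lborel (\<lambda>x. norm (F n x)) (\<bar>q n\<bar> * (Gamma (a n) / p powr a n))" for n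
  proof -
    have "norm (F n x) = \<bar>q n\<bar> * (indicator {0<..} x * (x powr (a n - 1) * exp (- p * x)))" for x
      by (simp add: F_def abs_mult)
    then show ?thesis
      by (simp only:) (intro has_bochner_integral_mult_right laplace_powr a assms)
  qed
  have val: "q n * (Gamma (a n) / p powr a n) = 1 / p powr b * (- c / p powr b) ^ n" for n
    using Gamma_real_pos[OF a[of n]] by (simp only: power_divide) (simp add: q_def p_a)
  have norm_val: "\<bar>q n\<bar> * (Gamma (a n) / p powr a n) = 1 / p powr b * (\<bar>c\<bar> / p powr b) ^ n" for n
    using Gamma_real_pos[OF a[of n]] by (simp add: q_def p_a power_divide power_abs)
  have 1: "integrable lborel (F n)" for n
    using F_int by (rule integrable.intros)
  have 2: "AE x in lborel. summable (\<lambda>n. norm (F n x))"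
  proof (rule AE_I2)
    fix x
    have "norm (F n x) = norm (indicator {0<..} x * x powr (b - 1) * exp (- p * x))
        * norm (q n * (x powr b) ^ n)" for n
      unfolding F_eq norm_mult ..
    then show "summable (\<lambda>n. norm (F n x))"
      using summable_mittag_leffler[OF \<open>b > 0\<close>, of c "x powr b"]
      by (simp only: q_def a_def summable_mult)
  qed
  have 3: "summable (\<lambda>n. LINT x|lborel. norm (F n x))"
    unfolding has_bochner_integral_integral_eq[OF F_norm] norm_val
    using assms by (intro summable_mult summable_geometric) simp
  have "(\<Sum>n. 1 / p powr b * (- c / p powr b) ^ n) = 1 / (p powr b + c)"
  proof -
    have "\<bar>- c / p powr b\<bar> < 1" "p powr b > 0" "p powr b + c > 0"
      using assms by auto
    then show ?thesis
      by (subst suminf_mult) (auto simp: summable_geometric suminf_geometric field_simps)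
  qed
  then have "(LINT x|lborel. (\<Sum>n. F n x)) = 1 / (p powr b + c)"
    by (simp only: integral_suminf[OF 1 2 3] has_bochner_integral_integral_eq[OF F_int] val)
  with integrable_suminf[OF 1 2 3] show ?thesis
    unfolding F_sum[symmetric] by (simp add: has_bochner_integral_iff)
qed

section \<open>The explicit density and its behaviour at 0\<close>

text \<open>Here \<theta> is any positive number, because the inverse Gaussian case puts
  \<open>\<theta> * \<delta> * sqrt 2\<close> in its place, which may exceed 1.\<close>

lemma tempered_density_asymptotics:
  fixes \<theta> l b :: real and f :: "real \<Rightarrow> real"
  assumes "\<theta> > 0" "l > 0" "b > 0" and pdf: "pdf_on_pos f"
    and f_laplace: "\<And>s. s > 0 \<Longrightarrow> laplace_transform f s = 1 / (1 + \<theta> * ((s + l) powr b - l powr b))"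
  shows "\<exists>g. continuous_version f g"
    and "continuous_version f g \<Longrightarrow> g \<sim>[at_right 0] (\<lambda>x. x powr (b - 1) / (\<theta> * Gamma b))"
proof -
  define c where "c = 1 / \<theta> - l powr b"
  define G where "G x = exp (- l * x) * (x powr (b - 1) * mittag_leffler b c (x powr b)) / \<theta>" for x
  have isCont_ml: "isCont (\<lambda>x. mittag_leffler b c (x powr b)) x" if "x > 0" for x
    using that by (intro isCont_o2[OF _ isCont_mittag_leffler[OF \<open>b > 0\<close>]] continuous_intros) simp
  have G_cont: "continuous_on {0<..} G"
    unfolding G_def continuous_on_eq_continuous_at[OF open_greaterThan]
    using isCont_ml \<open>\<theta> > 0\<close> by (auto intro!: continuous_intros)
  \<comment> \<open>For \<open>s \<ge> s0\<close> the argument \<open>p = s + l\<close> satisfies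
    \<open>\<bar>c\<bar> < p powr b\<close>, the range in which the transform of the series has been
    computed.\<close>
  define s0 where "s0 = (\<bar>c\<bar> + 1) powr (1 / b)"
  have s0: "s0 > 0" "s0 powr b = \<bar>c\<bar> + 1"
    using \<open>b > 0\<close> by (auto simp: s0_def powr_powr)
  \<comment> \<open>The weight \<open>exp (- s0 * x)\<close> secures integrability and turns the
    \<open>n\<close>-th exponential moment of \<open>k\<close> into the difference of the two
    transforms at \<open>s0 + n\<close>, where both are known and agree.\<close>
  define k where "k x = indicator {0<..} x * (exp (- s0 * x) * (f x - G x))" for x
  have f_int: "has_bochner_integral lborel (\<lambda>x. indicator {0<..} x * (exp (- s * x) * f x))
      (laplace_transform f s)" if "s > 0" for s
  proof -
    have int: "integrable lborel (\<lambda>x. indicator {0<..} x * f x)"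
      using pdf by (simp add: pdf_on_pos_def set_integrable_def)
    then have [measurable]: "(\<lambda>x. indicator {0<..} x * f x) \<in> borel_measurable borel"
      by simp
    have "integrable lborel (\<lambda>x. exp (- s * x) * (indicator {0<..} x * f x))"
    proof (rule Bochner_Integration.integrable_bound[OF int])
      show "AE x in lborel. norm (exp (- s * x) * (indicator {0<..} x * f x)) \<le> norm (indicator {0<..} x * f x)"
        using \<open>s > 0\<close> by (auto simp: abs_mult indicator_def intro!: mult_left_le_one_le)
    qed measurable
    then show ?thesis
      by (simp add: has_bochner_integral_iff laplace_transform_def set_lebesgue_integral_def mult_ac)
  qed
  \<comment> \<open>The factor \<open>exp (- l * x)\<close> in \<open>G\<close> shifts the argument
    of the transform from \<open>s\<close> to \<open>s + l\<close>.\<close>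
  have G_int: "has_bochner_integral lborel (\<lambda>x. indicator {0<..} x * (exp (- s * x) * G x))
      (1 / (1 + \<theta> * ((s + l) powr b - l powr b)))" if "s \<ge> s0" for s
  proof -
    have "s0 powr b \<le> (s + l) powr b"
      using that s0 \<open>l > 0\<close> \<open>b > 0\<close> by (intro powr_mono2) auto
    then have "\<bar>c\<bar> < (s + l) powr b"
      using s0 by simp
    from has_bochner_integral_mult_right[OF laplace_mittag_leffler[OF \<open>b > 0\<close> _ this], of "1 / \<theta>"]
    have "has_bochner_integral lborel (\<lambda>x. 1 / \<theta> * (indicator {0<..} x *
        (x powr (b - 1) * mittag_leffler b c (x powr b) * exp (- (s + l) * x)))) (1 / \<theta> * (1 / ((s + l) powr b + c)))"
      using that s0 \<open>l > 0\<close> by simp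
    also have "(\<lambda>x. 1 / \<theta> * (indicator {0<..} x *
        (x powr (b - 1) * mittag_leffler b c (x powr b) * exp (- (s + l) * x))))
        = (\<lambda>x. indicator {0<..} x * (exp (- s * x) * G x))"
      by (simp add: G_def fun_eq_iff distrib_right exp_add exp_diff exp_minus field_simps)
    also have "1 / \<theta> * (1 / ((s + l) powr b + c)) = 1 / (1 + \<theta> * ((s + l) powr b - l powr b))"
      using \<open>\<theta> > 0\<close> by (simp add: c_def algebra_simps)
    finally show ?thesis .
  qed
  have diff_int: "has_bochner_integral lborel (\<lambda>x. indicator {0<..} x * (exp (- s * x) * (f x - G x))) 0"
    if "s \<ge> s0" for s
    using has_bochner_integral_diff[OF f_int[of s] G_int[OF that]] f_laplace[of s] that s0
    by (simp add: right_diff_distrib)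
  have "AE x in lborel. k x = 0"
  proof (rule exp_moments_zero_imp_AE_zero)
    show "integrable lborel k"
      unfolding k_def using diff_int[of s0] by (simp add: has_bochner_integral_iff)
    show "(LINT x|lborel. exp (- x) ^ n * k x) = 0" for n
    proof -
      have "exp (- x) ^ n * k x = indicator {0<..} x * (exp (- (s0 + real n) * x) * (f x - G x))" for x
        by (simp add: k_def distrib_right exp_diff exp_minus exp_of_nat2_mult field_simps power_inverse)
      then show ?thesis
        using has_bochner_integral_integral_eq[OF diff_int[of "s0 + real n"]] by simp
    qed
  qed (simp add: k_def)
  then have G_eq_f: "AE x in lborel. 0 < x \<longrightarrow> G x = f x"
    by eventually_elim (auto simp: k_def)
  show "\<exists>g. continuous_version f g"
    using G_cont G_eq_f by (auto simp: continuous_version_def)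
  have "((\<lambda>x. x powr b) \<longlongrightarrow> 0) (at_right (0::real))"
    by (rule tendsto_zero_powrI)
      (auto intro: \<open>b > 0\<close> eventually_mono[OF eventually_at_right_less])
  then have "((\<lambda>x. mittag_leffler b c (x powr b)) \<longlongrightarrow> 1 / Gamma b) (at_right 0)"
    using isCont_tendsto_compose[OF isCont_mittag_leffler[OF \<open>b > 0\<close>], of _ 0]
    by (simp add: mittag_leffler_0)
  \<comment> \<open>For positive \<open>x\<close> this product is the quotient of \<open>G\<close>
    by the claimed equivalent, the powers of \<open>x\<close> and \<theta> having cancelled.\<close>
  then have "((\<lambda>x. exp (- l * x) * mittag_leffler b c (x powr b) * Gamma b) \<longlongrightarrow>
      exp (- l * 0) * (1 / Gamma b) * Gamma b) (at_right 0)"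
    by (intro tendsto_intros)
  then have lim: "((\<lambda>x. exp (- l * x) * mittag_leffler b c (x powr b) * Gamma b) \<longlongrightarrow> 1) (at_right 0)"
    using Gamma_real_pos[OF \<open>b > 0\<close>] by simp
  have G_asymp: "G \<sim>[at_right 0] (\<lambda>x. x powr (b - 1) / (\<theta> * Gamma b))"
  proof (rule asymp_equivI', rule Lim_transform_eventually[OF lim])
    show "\<forall>\<^sub>F x in at_right 0. exp (- l * x) * mittag_leffler b c (x powr b) * Gamma b
        = G x / (x powr (b - 1) / (\<theta> * Gamma b))"
      using eventually_at_right_less
      by eventually_elim (use \<open>\<theta> > 0\<close> in \<open>auto simp: G_def\<close>)
  qed
  assume g: "continuous_version f g"
  then have g': "continuous_on {0<..} g" "AE x in lborel. 0 < x \<longrightarrow> g x = f x"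
    by (auto simp: continuous_version_def)
  have ae: "AE x in lborel. x \<in> {0<..} \<longrightarrow> g x = G x"
    using g'(2) G_eq_f by eventually_elim simp
  have "g x = G x" if "x > 0" for x
    by (rule AE_eq_imp_eq_on_open[OF open_greaterThan g'(1) G_cont ae]) (simp add: that)
  then have "\<forall>\<^sub>F x in at_right 0. g x = G x"
    using eventually_at_right_less by (rule eventually_mono[rotated])
  from asymp_equiv_cong[OF this always_eventually[OF allI[OF refl]]] G_asymp
  show "g \<sim>[at_right 0] (\<lambda>x. x powr (b - 1) / (\<theta> * Gamma b))"
    by blast
qed

theorem theorem2p1:
  fixes \<theta> :: real
  assumes "0 < \<theta>" and "\<theta> < 1"
  shows
    "(\<forall>(l::real) (\<beta>::real) (f::real \<Rightarrow> real).
        0 < l \<longrightarrow> 0 < \<beta> \<longrightarrow> \<beta> < 1 \<longrightarrow> pdf_on_pos f \<longrightarrow>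
        (\<forall>s>0. laplace_transform f s = 1 / (1 + \<theta> * ((s + l) powr \<beta> - l powr \<beta>))) \<longrightarrow>
        (\<exists>g. continuous_version f g) \<and>
        (\<forall>g. continuous_version f g \<longrightarrow>
           g \<sim>[at_right 0] (\<lambda>x. x powr (\<beta> - 1) / (\<theta> * Gamma \<beta>))))
     \<and>
     (\<forall>(\<delta>::real) (\<gamma>::real) (f::real \<Rightarrow> real).
        0 < \<delta> \<longrightarrow> 0 < \<gamma> \<longrightarrow> pdf_on_pos f \<longrightarrow>
        (\<forall>s>0. laplace_transform f s = 1 / (1 + \<theta> * \<delta> * (sqrt (\<gamma>\<^sup>2 + 2 * s) - \<gamma>))) \<longrightarrow>
        (\<exists>g. continuous_version f g) \<and>
        (\<forall>g. continuous_version f g \<longrightarrow>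
           g \<sim>[at_right 0] (\<lambda>x. x powr (- 1 / 2) / (\<theta> * \<delta> * sqrt (2 * pi)))))"
proof (intro conjI allI impI)
  fix l \<beta> :: real and f :: "real \<Rightarrow> real"
  assume "0 < l" "0 < \<beta>" "\<beta> < 1" "pdf_on_pos f"
    and L: "\<forall>s>0. laplace_transform f s = 1 / (1 + \<theta> * ((s + l) powr \<beta> - l powr \<beta>))"
  note * = tempered_density_asymptotics[OF \<open>0 < \<theta>\<close> \<open>0 < l\<close> \<open>0 < \<beta>\<close> \<open>pdf_on_pos f\<close> L[rule_format]]
  show "\<exists>g. continuous_version f g"
    by (rule *)
  show "g \<sim>[at_right 0] (\<lambda>x. x powr (\<beta> - 1) / (\<theta> * Gamma \<beta>))" if "continuous_version f g" for g
    using *(2)[OF _ that] .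
next
  fix \<delta> \<gamma> :: real and f :: "real \<Rightarrow> real"
  assume "0 < \<delta>" "0 < \<gamma>" "pdf_on_pos f"
    and L: "\<forall>s>0. laplace_transform f s = 1 / (1 + \<theta> * \<delta> * (sqrt (\<gamma>\<^sup>2 + 2 * s) - \<gamma>))"
  have L': "laplace_transform f s
      = 1 / (1 + \<theta> * \<delta> * sqrt 2 * ((s + \<gamma>\<^sup>2 / 2) powr (1 / 2) - (\<gamma>\<^sup>2 / 2) powr (1 / 2)))" if "s > 0" for s
  proof -
    \<comment> \<open>Pulling \<open>sqrt 2\<close> out of the root leaves \<open>s\<close> with
      coefficient 1, the form that the tempered case requires.\<close>
    have "sqrt 2 * (s + \<gamma>\<^sup>2 / 2) powr (1 / 2) = sqrt (\<gamma>\<^sup>2 + 2 * s)"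
      using that by (simp add: powr_half_sqrt flip: real_sqrt_mult)
    moreover have "sqrt 2 * (\<gamma>\<^sup>2 / 2) powr (1 / 2) = \<gamma>"
      using \<open>0 < \<gamma>\<close> by (simp add: powr_half_sqrt flip: real_sqrt_mult)
    ultimately have "sqrt 2 * ((s + \<gamma>\<^sup>2 / 2) powr (1 / 2) - (\<gamma>\<^sup>2 / 2) powr (1 / 2))
        = sqrt (\<gamma>\<^sup>2 + 2 * s) - \<gamma>"
      by (simp only: right_diff_distrib)
    then show ?thesis
      using L that by (simp only: mult.assoc)
  qed
  have pos: "0 < \<theta> * \<delta> * sqrt 2" "0 < \<gamma>\<^sup>2 / 2" "0 < (1 / 2 :: real)"
    using \<open>0 < \<theta>\<close> \<open>0 < \<delta>\<close> \<open>0 < \<gamma>\<close> by auto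
  note * = tempered_density_asymptotics[OF pos \<open>pdf_on_pos f\<close> L']
  show "\<exists>g. continuous_version f g"
    by (rule *)
  show "g \<sim>[at_right 0] (\<lambda>x. x powr (- 1 / 2) / (\<theta> * \<delta> * sqrt (2 * pi)))"
    if "continuous_version f g" for g
    \<comment> \<open>The value \<open>sqrt pi\<close> of Gamma at 1/2 combines with the rescaling
      factor \<open>sqrt 2\<close> to give \<open>sqrt (2 * pi)\<close>.\<close>
    using *(2)[OF _ that] by (simp add: Gamma_one_half_real real_sqrt_mult mult.assoc)
qed

end
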